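(* For any $n\in\mathbb{N}$, there exist graphs $G$ with $n$ vertices such that any algorithm in the one-pass streaming model computing an $(\varepsilon_\mathcal{D},\varepsilon_\mathcal{R})$-BiCriteria Multiplicative Approximation of the ccdh of $G$, for any $\varepsilon_\mathcal{D}<\frac12$ and $\varepsilon_\mathcal{R}<1$, must use $\Omega(n)$ space.
   Context: Streaming model: the edges of a simple graph $G=(V,E)$ arrive one by one in arbitrary order (insertion-only), and the algorithm makes one pass using limited memory; algorithms may be randomized. The ccdh of $G$ is $C(y)=|\{v\in V:\deg(v)\ge y\}|$ where $\deg(v)$ is the degree of $v$. $\widehat{C}$ is an $(\varepsilon_\mathcal{D},\varepsilon_\mathcal{R})$-BiCriteria Multiplicative Approximation of $C$ if for every $d$, $(1-\varepsilon_\mathcal{R})C((1+\varepsilon_\mathcal{D})d)\le\widehat{C}(d)\le(1+\varepsilon_\mathcal{R})C((1-\varepsilon_\mathcal{D})d)$. *)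

theory Defs
  imports "HOL-Probability.Probability" "HOL-Combinatorics.Multiset_Permutations"
begin

definition simple_graph :: "'v set \<Rightarrow> 'v set set \<Rightarrow> bool" where
  "simple_graph V E \<longleftrightarrow> finite V \<and> E \<subseteq> {e. e \<subseteq> V \<and> card e = 2}"

definition vertex_degree :: "'v set set \<Rightarrow> 'v \<Rightarrow> nat" where
  "vertex_degree E v = card {e \<in> E. v \<in> e}"

text \<open>The argument is real because the bicriteria condition evaluates the ccdh at
  non-integral thresholds.\<close>

definition ccdh :: "'v set \<Rightarrow> 'v set set \<Rightarrow> real \<Rightarrow> nat" where
  "ccdh V E y = card {v \<in> V. real (vertex_degree E v) \<ge> y}"

definition bicriteria_approx ::
    "real \<Rightarrow> real \<Rightarrow> (real \<Rightarrow> nat) \<Rightarrow> (nat \<Rightarrow> real) \<Rightarrow> bool" where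
  "bicriteria_approx \<epsilon>D \<epsilon>R C C' \<longleftrightarrow>
     (\<forall>d. (1 - \<epsilon>R) * real (C ((1 + \<epsilon>D) * real d)) \<le> C' d \<and>
          C' d \<le> (1 + \<epsilon>R) * real (C ((1 - \<epsilon>D) * real d)))"

text \<open>A randomized one-pass algorithm over a stream of edges. The memory contents are a bit
  string; everything the algorithm carries over from one edge to the next is in it. Fresh coins
  may be tossed at initialization, at each edge and when producing the output, which is the
  function approximating the ccdh. The maps are arbitrary, so neither computation time nor
  the working space used within a single update is charged.\<close>

record 'v streaming_algorithm =
  initial :: "bool list pmf"
  update :: "bool list \<Rightarrow> 'v set \<Rightarrow> bool list pmf"
  result :: "bool list \<Rightarrow> (nat \<Rightarrow> real) pmf"

definition memory_after :: "'v streaming_algorithm \<Rightarrow> 'v set list \<Rightarrow> bool list pmf" where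
  "memory_after A es = foldl (\<lambda>M e. bind_pmf M (\<lambda>m. update A m e)) (initial A) es"

definition output_dist :: "'v streaming_algorithm \<Rightarrow> 'v set list \<Rightarrow> (nat \<Rightarrow> real) pmf" where
  "output_dist A es = bind_pmf (memory_after A es) (result A)"

text \<open>The insertion-only streams of a graph are the enumerations of its edge set without
  repetition. The two predicates below range over all graphs of a class (a set of edge sets) and
  all arrival orders: correctness with probability at least \<open>p\<close> on each stream, and at
  most \<open>s\<close> bits of memory at any time and for any outcome of the coin tosses.\<close>

definition computes_ccdh_approx ::
    "'v streaming_algorithm \<Rightarrow> 'v set \<Rightarrow> 'v set set set \<Rightarrow> real \<Rightarrow> real \<Rightarrow> real \<Rightarrow> bool" where
  "computes_ccdh_approx A V \<G> \<epsilon>D \<epsilon>R p \<longleftrightarrow>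
     (\<forall>E\<in>\<G>. \<forall>es\<in>permutations_of_set E.
        measure_pmf.prob (output_dist A es)
          {C'. bicriteria_approx \<epsilon>D \<epsilon>R (ccdh V E) C'} \<ge> p)"

definition uses_space_at_most :: "'v streaming_algorithm \<Rightarrow> 'v set set set \<Rightarrow> nat \<Rightarrow> bool" where
  "uses_space_at_most A \<G> s \<longleftrightarrow>
     (\<forall>E\<in>\<G>. \<forall>es\<in>permutations_of_set E. \<forall>k\<le>length es.
        \<forall>m\<in>set_pmf (memory_after A (take k es)). length m \<le> s)"

end

theory Submission
  imports Defs
begin

text \<open>
  For \<open>\<epsilon>D < 1/2\<close> and \<open>\<epsilon>R < 1\<close> the value at \<open>d = 2\<close> tells a vertex of degree 3 from maximum degree 1,
  so one pass solves three-party one-way unique disjointness. Item \<open>j\<close> is a potential star with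
  centre \<open>4 j\<close>: the first two players draw their leaf for the items in their sets \<open>A\<close> and \<open>B\<close>,
  and the third player draws a leaf for one item \<open>i\<close> only. A correct algorithm has to accept
  \<open>(A + i, B + i)\<close> and to reject \<open>(A, B)\<close> when \<open>A\<close> and \<open>B\<close> are disjoint and avoid \<open>i\<close>. Passing through
  \<open>(A, B + i)\<close>, one of the two memory states that are handed over must reveal membership of \<open>i\<close> in
  a single player's set. Average over all sets \<open>S\<close> of items, \<open>A\<close> within \<open>S\<close> and \<open>B\<close> within the complement
  of \<open>S\<close>: then each handed-over state is a function of a uniformly random subset, and a state of
  \<open>s\<close> bits can depend noticeably on only \<open>O(s)\<close> of the items. The step from \<open>(A, B)\<close> to
  \<open>(A, B + i)\<close> is charged to \<open>S\<close> and the step from \<open>(A, B + i)\<close> to \<open>(A + i, B + i)\<close> to \<open>S + i\<close>.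
\<close>


section \<open>Exponential moments of random signed sums and total influence\<close>

lemma exp_plus_exp_minus_le:
  fixes x :: real
  shows "exp x + exp (- x) \<le> 2 * exp (x\<^sup>2 / 2)"
proof -
  have *: "exp y + exp (- y) \<le> 2 * exp (y\<^sup>2 / 2)" if "y \<ge> 0" for y :: real
  proof -
    \<comment> \<open>Hoeffding's lemma for a fair coin with values 0 and \<open>2 * y\<close>;
      centring it gives the sign \<plusminus>\<open>y\<close>.\<close>
    have "- (2 * y) * (1/2) + ln (1 + (1/2) * (exp (2 * y) - 1)) \<le> (2 * y)\<^sup>2 / 8"
      using that by (intro Hoeffdings_lemma_aux) auto
    hence "ln ((1 + exp (2 * y)) / 2) \<le> y + y\<^sup>2 / 2"
      by (simp add: field_simps)
    hence "(1 + exp (2 * y)) / 2 \<le> exp (y + y\<^sup>2 / 2)"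
      by (smt (verit) exp_gt_zero exp_le_cancel_iff exp_ln half_gt_zero)
    hence "exp (- y) * (1 + exp (2 * y)) \<le> exp (- y) * (2 * exp (y + y\<^sup>2 / 2))"
      by (intro mult_left_mono) auto
    thus ?thesis
      by (simp add: distrib_left mult.left_commute[of _ 2] add.commute flip: exp_add)
  qed
  show ?thesis
    using *[of x] *[of "- x"] by (cases "x \<ge> 0") (auto simp: add.commute)
qed

text \<open>Pairing \<open>X\<close> with \<open>insert i X\<close> turns a degree-one Fourier
  coefficient, up to normalisation, into a sum of discrete derivatives in direction
  \<open>i\<close>.\<close>

lemma sum_signed_Pow:
  fixes f :: "'a set \<Rightarrow> real"
  assumes "finite U" "i \<in> U"
  shows "(\<Sum>X\<in>Pow U. (if i \<in> X then 1 else -1) * f X) = (\<Sum>X\<in>Pow (U - {i}). f (insert i X) - f X)"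
proof -
  have U: "Pow U = Pow (U - {i}) \<union> insert i ` Pow (U - {i})"
    using assms(2) Pow_insert[of i "U - {i}"] by (simp add: insert_absorb)
  have inj: "inj_on (insert i) (Pow (U - {i}))"
    by (rule inj_onI) blast
  have "(\<Sum>X\<in>Pow U. (if i \<in> X then 1 else -1) * f X) =
     (\<Sum>X\<in>Pow (U - {i}). (if i \<in> X then 1 else -1) * f X) +
     (\<Sum>X\<in>insert i ` Pow (U - {i}). (if i \<in> X then 1 else -1) * f X)"
    unfolding U by (rule sum.union_disjoint) (use assms in auto)
  also have "(\<Sum>X\<in>insert i ` Pow (U - {i}). (if i \<in> X then 1 else -1) * f X) =
     (\<Sum>X\<in>Pow (U - {i}). f (insert i X))"
    by (subst sum.reindex[OF inj]) simp
  also have "(\<Sum>X\<in>Pow (U - {i}). (if i \<in> X then 1 else -1) * f X) = (\<Sum>X\<in>Pow (U - {i}). - f X)"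
    by (rule sum.cong) auto
  finally show ?thesis
    by (simp add: sum_subtractf sum_negf)
qed

text \<open>The signs are independent: the sum over subsets is the expansion of a product over
  \<open>U\<close>, and each factor is bounded separately.\<close>

lemma sum_exp_signed_Pow_le:
  fixes h :: "'a \<Rightarrow> real"
  assumes "finite U" "\<And>i. i \<in> U \<Longrightarrow> \<bar>h i\<bar> \<le> l"
  shows "(\<Sum>X\<in>Pow U. exp (\<Sum>i\<in>U. h i * (if i \<in> X then 1 else -1))) \<le> 2 ^ card U * exp (real (card U) * l\<^sup>2 / 2)"
proof -
  have "exp (\<Sum>i\<in>U. h i * (if i \<in> X then 1 else -1)) =
      (\<Prod>i\<in>X. exp (h i)) * (\<Prod>i\<in>U - X. exp (- h i))" if "X \<in> Pow U" for X
  proof -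
    have "exp (\<Sum>i\<in>U. h i * (if i \<in> X then 1 else -1)) =
        (\<Prod>i\<in>U. if i \<in> X then exp (h i) else exp (- h i))"
      using assms(1) by (auto simp: exp_sum intro!: prod.cong)
    also have "\<dots> = (\<Prod>i\<in>X. exp (h i)) * (\<Prod>i\<in>U - X. exp (- h i))"
      using assms(1) that by (simp add: prod.If_cases Int_absorb1 Diff_eq)
    finally show ?thesis .
  qed
  hence "(\<Sum>X\<in>Pow U. exp (\<Sum>i\<in>U. h i * (if i \<in> X then 1 else -1))) =
      (\<Prod>i\<in>U. exp (h i) + exp (- h i))"
    using prod_add[OF assms(1), of "\<lambda>i. exp (h i)" "\<lambda>i. exp (- h i)"] by simp
  also have "\<dots> \<le> (\<Prod>i\<in>U. 2 * exp (l\<^sup>2 / 2))"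
  proof (rule prod_mono, safe)
    fix i assume "i \<in> U"
    hence "(h i)\<^sup>2 \<le> l\<^sup>2"
      using assms(2)[of i] by (intro abs_le_square_iff[THEN iffD1]) auto
    thus "exp (h i) + exp (- h i) \<le> 2 * exp (l\<^sup>2 / 2)"
      by (intro order.trans[OF exp_plus_exp_minus_le]) simp
  qed (auto intro: add_nonneg_nonneg)
  also have "\<dots> = 2 ^ card U * exp (real (card U) * l\<^sup>2 / 2)"
    by (simp add: power_mult_distrib flip: exp_of_nat_mult)
  finally show ?thesis .
qed

text \<open>Read \<open>K X\<close> as the distribution of a message about \<open>X\<close>. The left side is the expectation, up to
  the factor \<open>2 ^ card U\<close>, of a signed sum \<open>Z\<close> selected by the message among \<open>card N\<close> many, hence at
  most the expected maximum of \<open>card N\<close> subgaussian variables.\<close>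

lemma sum_influences_le:
  fixes K :: "'a set \<Rightarrow> 'b \<Rightarrow> real" and g :: "'a \<Rightarrow> 'b \<Rightarrow> real" and l :: real
  assumes U: "finite U" and N: "finite N" "N \<noteq> {}" and l: "l > 0"
    and K: "\<And>X x. X \<subseteq> U \<Longrightarrow> K X x \<ge> 0" "\<And>X. X \<subseteq> U \<Longrightarrow> (\<Sum>x\<in>N. K X x) = 1"
    and g: "\<And>i x. \<bar>g i x\<bar> \<le> 1"
  shows "(\<Sum>i\<in>U. \<Sum>X\<in>Pow (U - {i}). (\<Sum>x\<in>N. K (insert i X) x * g i x) - (\<Sum>x\<in>N. K X x * g i x))
     \<le> 2 ^ card U * (ln (card N) / l + l * card U / 2)"
proof -
  define Z where "Z x X = (\<Sum>i\<in>U. g i x * (if i \<in> X then 1 else -1))" for x X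
  \<comment> \<open>\<open>exp a\<close> bounds the exponential moments of \<open>l * Z x X\<close>,
    averaged over \<open>X\<close> and summed over all messages \<open>x\<close>.\<close>
  define a where "a = ln (card N) + real (card U) * l\<^sup>2 / 2"
  have cN: "real (card N) > 0"
    using N by (simp add: card_gt_0_iff)
  have "(\<Sum>i\<in>U. \<Sum>X\<in>Pow (U - {i}). (\<Sum>x\<in>N. K (insert i X) x * g i x) - (\<Sum>x\<in>N. K X x * g i x)) =
      (\<Sum>i\<in>U. \<Sum>X\<in>Pow U. (if i \<in> X then 1 else -1) * (\<Sum>x\<in>N. K X x * g i x))"
    by (rule sum.cong[OF refl], rule sum_signed_Pow[OF U, symmetric])
  also have "\<dots> = (\<Sum>X\<in>Pow U. \<Sum>i\<in>U. \<Sum>x\<in>N. K X x * (g i x * (if i \<in> X then 1 else -1)))"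
    by (subst sum.swap) (auto simp: sum_distrib_left mult_ac intro!: sum.cong)
  also have "\<dots> = (\<Sum>X\<in>Pow U. \<Sum>x\<in>N. K X x * Z x X)"
    unfolding Z_def sum_distrib_left by (intro sum.cong refl sum.swap)
  finally have eq: "(\<Sum>i\<in>U. \<Sum>X\<in>Pow (U - {i}). (\<Sum>x\<in>N. K (insert i X) x * g i x) - (\<Sum>x\<in>N. K X x * g i x))
      = (\<Sum>X\<in>Pow U. \<Sum>x\<in>N. K X x * Z x X)" .
  have "l * (\<Sum>X\<in>Pow U. \<Sum>x\<in>N. K X x * Z x X) = (\<Sum>X\<in>Pow U. \<Sum>x\<in>N. K X x * (l * Z x X))"
    by (simp add: sum_distrib_left mult_ac)
  also have "\<dots> \<le> (\<Sum>X\<in>Pow U. (a - 1) + (\<Sum>x\<in>N. exp (l * Z x X - a)))"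
  proof (intro sum_mono)
    fix X assume X: "X \<in> Pow U"
    have K1: "K X x \<le> 1" if "x \<in> N" for x
      using member_le_sum[OF that, of "K X"] K[of X] X N by auto
    have "(\<Sum>x\<in>N. K X x * (l * Z x X)) \<le> (\<Sum>x\<in>N. K X x * (a - 1) + exp (l * Z x X - a))"
    proof (intro sum_mono)
      fix x assume x: "x \<in> N"
      \<comment> \<open>The tangent to \<open>exp\<close> at 0. Being linear in the weights
        \<open>K X x\<close>, it replaces the usual appeal to Jensen's inequality.\<close>
      have "l * Z x X \<le> (a - 1) + exp (l * Z x X - a)"
        using exp_ge_add_one_self[of "l * Z x X - a"] by linarith
      hence "K X x * (l * Z x X) \<le> K X x * (a - 1) + K X x * exp (l * Z x X - a)"
        using K(1)[of X x] X by (metis PowD mult_left_mono distrib_left)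
      \<comment> \<open>Dropping the weight lets every message contribute fully. This union bound
        costs the factor \<open>card N\<close>, hence the logarithm in the result.\<close>
      also have "K X x * exp (l * Z x X - a) \<le> exp (l * Z x X - a)"
        using K1[OF x] by (simp add: mult_left_le_one_le)
      finally show "K X x * (l * Z x X) \<le> K X x * (a - 1) + exp (l * Z x X - a)"
        by simp
    qed
    also have "\<dots> = (a - 1) + (\<Sum>x\<in>N. exp (l * Z x X - a))"
      using K(2)[of X] X by (simp add: sum.distrib flip: sum_distrib_right)
    finally show "(\<Sum>x\<in>N. K X x * (l * Z x X)) \<le> (a - 1) + (\<Sum>x\<in>N. exp (l * Z x X - a))" .
  qed
  also have "\<dots> = 2 ^ card U * (a - 1) + exp (- a) * (\<Sum>x\<in>N. \<Sum>X\<in>Pow U. exp (l * Z x X))"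
    by (subst sum.swap) (simp add: sum.distrib sum_subtractf card_Pow[OF U] sum_distrib_left
      exp_diff exp_minus divide_inverse mult.commute)
  also have "\<dots> \<le> 2 ^ card U * (a - 1) + exp (- a) * (\<Sum>x\<in>N. 2 ^ card U * exp (real (card U) * l\<^sup>2 / 2))"
  proof (intro add_left_mono mult_left_mono sum_mono)
    fix x assume "x \<in> N"
    have "(\<Sum>X\<in>Pow U. exp (\<Sum>i\<in>U. l * g i x * (if i \<in> X then 1 else -1))) \<le> 2 ^ card U * exp (real (card U) * l\<^sup>2 / 2)"
      using U l g by (intro sum_exp_signed_Pow_le) (auto simp: abs_mult intro: mult_left_le)
    thus "(\<Sum>X\<in>Pow U. exp (l * Z x X)) \<le> 2 ^ card U * exp (real (card U) * l\<^sup>2 / 2)"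
      by (simp add: Z_def sum_distrib_left mult.assoc)
  qed simp
  also have "\<dots> = 2 ^ card U * (a - 1) + 2 ^ card U * (exp (- a) * (card N * exp (real (card U) * l\<^sup>2 / 2)))"
    by (simp add: mult_ac)
  also have "card N * exp (real (card U) * l\<^sup>2 / 2) = exp a"
    using cN by (simp add: a_def exp_add)
  also have "2 ^ card U * (a - 1) + 2 ^ card U * (exp (- a) * exp a) = 2 ^ card U * a"
    by (simp add: algebra_simps flip: exp_add)
  finally have "(\<Sum>X\<in>Pow U. \<Sum>x\<in>N. K X x * Z x X) \<le> 2 ^ card U * a / l"
    using l by (simp add: pos_le_divide_eq mult.commute)
  also have "\<dots> = 2 ^ card U * (ln (card N) / l + l * card U / 2)"
    using l by (simp add: a_def field_simps power2_eq_square)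
  finally show ?thesis
    unfolding eq .
qed

section \<open>Double counting over splittings of the items\<close>

text \<open>Removing \<open>i\<close> from \<open>S\<close> is a bijection between pairs with
  \<open>i \<in> S\<close> and pairs with \<open>i \<notin> S\<close>. It serves to charge a step to
  \<open>insert i S\<close> instead of \<open>S\<close>.\<close>

lemma sum_pairs_insert:
  fixes f :: "'a set \<Rightarrow> 'a \<Rightarrow> real"
  assumes "finite I"
  shows "(\<Sum>S\<in>Pow I. \<Sum>i\<in>S. f S i) = (\<Sum>S\<in>Pow I. \<Sum>i\<in>I - S. f (insert i S) i)"
proof -
  have "(\<Sum>S\<in>Pow I. \<Sum>i\<in>S. f S i) = (\<Sum>(S, i)\<in>(SIGMA S:Pow I. S). f S i)"
    by (rule sum.Sigma) (use assms finite_subset in auto)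
  also have "\<dots> = (\<Sum>(S, i)\<in>(SIGMA S:Pow I. I - S). f (insert i S) i)"
    by (rule sum.reindex_bij_witness[of _ "\<lambda>(S, i). (insert i S, i)" "\<lambda>(S, i). (S - {i}, i)"])
      (auto simp: insert_absorb)
  also have "\<dots> = (\<Sum>S\<in>Pow I. \<Sum>i\<in>I - S. f (insert i S) i)"
    by (rule sum.Sigma[symmetric]) (use assms in auto)
  finally show ?thesis .
qed

lemma sum_card_Diff_Pow:
  assumes "finite I"
  shows "2 * (\<Sum>S\<in>Pow I. real (card (I - S))) = real (card I) * 2 ^ card I"
proof -
  have "(\<Sum>S\<in>Pow I. real (card (I - S))) = (\<Sum>S\<in>Pow I. real (card S))"
    by (rule sum.reindex_bij_witness[of _ "\<lambda>S. I - S" "\<lambda>S. I - S"]) (auto simp: double_diff)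
  moreover have "(\<Sum>S\<in>Pow I. real (card (I - S)) + real (card S)) = (\<Sum>S\<in>Pow I. real (card I))"
  proof (intro sum.cong refl)
    fix S assume "S \<in> Pow I"
    hence "card (I - S) + card S = card I"
      using assms by (simp add: card_Diff_subset card_mono finite_subset)
    thus "real (card (I - S)) + real (card S) = real (card I)"
      by linarith
  qed
  ultimately show ?thesis
    using assms by (simp add: sum.distrib card_Pow)
qed

text \<open>\<open>T1\<close> cuts the stream after the first player, so \<open>g1\<close> may still
  depend on \<open>B\<close>; \<open>T2\<close> cuts it after the second, so \<open>g2\<close> knows
  only \<open>i\<close>. Nothing is assumed about the hybrid value
  \<open>T A (insert i B) i\<close>: the gap is the sum of the increments before and after
  it.\<close>

lemma three_party_bound:
  fixes K1 :: "'a set \<Rightarrow> 'b \<Rightarrow> real" and K2 :: "'a set \<Rightarrow> 'a set \<Rightarrow> 'b \<Rightarrow> real"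
    and T :: "'a set \<Rightarrow> 'a set \<Rightarrow> 'a \<Rightarrow> real" and l \<delta> :: real
  assumes I: "finite I" and N: "finite N" "N \<noteq> {}" and l: "l > 0"
    and K1: "\<And>A x. A \<subseteq> I \<Longrightarrow> K1 A x \<ge> 0" "\<And>A. A \<subseteq> I \<Longrightarrow> (\<Sum>x\<in>N. K1 A x) = 1"
    and K2: "\<And>A B x. A \<subseteq> I \<Longrightarrow> B \<subseteq> I \<Longrightarrow> K2 A B x \<ge> 0"
      "\<And>A B. A \<subseteq> I \<Longrightarrow> B \<subseteq> I \<Longrightarrow> (\<Sum>x\<in>N. K2 A B x) = 1"
    and g: "\<And>B i x. \<bar>g1 B i x\<bar> \<le> 1" "\<And>i x. \<bar>g2 i x\<bar> \<le> 1"
    and T1: "\<And>A B i. A \<subseteq> I \<Longrightarrow> B \<subseteq> I \<Longrightarrow> i \<in> I \<Longrightarrow> T A B i = (\<Sum>x\<in>N. K1 A x * g1 B i x)"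
    and T2: "\<And>A B i. A \<subseteq> I \<Longrightarrow> B \<subseteq> I \<Longrightarrow> i \<in> I \<Longrightarrow> T A B i = (\<Sum>x\<in>N. K2 A B x * g2 i x)"
    and gap: "\<And>A B i. A \<subseteq> I \<Longrightarrow> B \<subseteq> I \<Longrightarrow> i \<in> I \<Longrightarrow> A \<inter> B = {} \<Longrightarrow> i \<notin> A \<union> B \<Longrightarrow>
        \<delta> \<le> T (insert i A) (insert i B) i - T A B i"
  shows "\<delta> * card I \<le> 8 * (ln (card N) / l + l * card I / 2)"
proof -
  define R where "R = ln (card N) / l + l * card I / 2"
  have le_R: "ln (card N) / l + l * card U / 2 \<le> R" if "U \<subseteq> I" for U
    using l card_mono[OF I that] by (simp add: R_def)
  have two: "(2::real) ^ card S * 2 ^ card (I - S) = 2 ^ card I" if "S \<subseteq> I" for S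
    using I that by (simp add: card_Diff_subset card_mono finite_subset flip: power_add)
  \<comment> \<open>\<open>D2\<close> collects the increments of the second player's set,
    \<open>D1\<close> those of the first player's.\<close>
  define D2 where "D2 = (\<Sum>S\<in>Pow I. \<Sum>i\<in>I - S. \<Sum>A\<in>Pow S. \<Sum>B\<in>Pow (I - S - {i}). T A (insert i B) i - T A B i)"
  define D1 where "D1 = (\<Sum>S\<in>Pow I. \<Sum>i\<in>I - S. \<Sum>A\<in>Pow S. \<Sum>B\<in>Pow (I - S - {i}). T (insert i A) (insert i B) i - T A (insert i B) i)"
  have "D2 = (\<Sum>S\<in>Pow I. \<Sum>A\<in>Pow S. \<Sum>i\<in>I - S. \<Sum>B\<in>Pow (I - S - {i}). T A (insert i B) i - T A B i)"
    unfolding D2_def by (intro sum.cong refl sum.swap)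
  also have "\<dots> \<le> (\<Sum>S\<in>Pow I. \<Sum>A\<in>Pow S. 2 ^ card (I - S) * R)"
  proof (intro sum_mono)
    fix S A assume S: "S \<in> Pow I" and A: "A \<in> Pow S"
    have "(\<Sum>i\<in>I - S. \<Sum>B\<in>Pow (I - S - {i}). T A (insert i B) i - T A B i) =
       (\<Sum>i\<in>I - S. \<Sum>B\<in>Pow (I - S - {i}). (\<Sum>x\<in>N. K2 A (insert i B) x * g2 i x) - (\<Sum>x\<in>N. K2 A B x * g2 i x))"
      by (intro sum.cong refl arg_cong2[where f = "(-)"] T2) (use S A in auto)
    also have "\<dots> \<le> 2 ^ card (I - S) * (ln (card N) / l + l * card (I - S) / 2)"
    proof (rule sum_influences_le)
      fix B assume "B \<subseteq> I - S"
      hence AB: "A \<subseteq> I" "B \<subseteq> I"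
        using S A by auto
      show "K2 A B x \<ge> 0" for x
        by (rule K2(1)[OF AB])
      show "(\<Sum>x\<in>N. K2 A B x) = 1"
        by (rule K2(2)[OF AB])
    qed (use I N l g in auto)
    also have "\<dots> \<le> 2 ^ card (I - S) * R"
      by (intro mult_left_mono le_R) auto
    finally show "(\<Sum>i\<in>I - S. \<Sum>B\<in>Pow (I - S - {i}). T A (insert i B) i - T A B i) \<le> 2 ^ card (I - S) * R" .
  qed
  also have "\<dots> = (\<Sum>S\<in>Pow I. 2 ^ card I * R)"
    by (intro sum.cong refl) (use I two in \<open>simp add: card_Pow finite_subset flip: mult.assoc\<close>)
  finally have D2: "D2 \<le> 4 ^ card I * R"
    using I by (simp add: card_Pow flip: mult.assoc power_mult_distrib)
  \<comment> \<open>Here \<open>i\<close> enters \<open>A\<close>, so it has to lie in the ground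
    set of \<open>A\<close>. That becomes \<open>insert i S\<close>, and its complement is where
    \<open>B\<close> already lives.\<close>
  have "D1 = (\<Sum>S\<in>Pow I. \<Sum>i\<in>I - S. \<Sum>A\<in>Pow (insert i S - {i}). \<Sum>B\<in>Pow (I - insert i S). T (insert i A) (insert i B) i - T A (insert i B) i)"
    unfolding D1_def
  proof (intro sum.cong refl)
    fix S i assume "S \<in> Pow I" "i \<in> I - S"
    thus "Pow S = Pow (insert i S - {i})" by auto
  next
    fix S i assume "S \<in> Pow I" "i \<in> I - S"
    show "Pow (I - S - {i}) = Pow (I - insert i S)" by auto
  qed
  also have "\<dots> = (\<Sum>S\<in>Pow I. \<Sum>i\<in>S. \<Sum>A\<in>Pow (S - {i}). \<Sum>B\<in>Pow (I - S). T (insert i A) (insert i B) i - T A (insert i B) i)"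
    by (rule sum_pairs_insert[OF I, symmetric])
  also have "\<dots> = (\<Sum>S\<in>Pow I. \<Sum>B\<in>Pow (I - S). \<Sum>i\<in>S. \<Sum>A\<in>Pow (S - {i}). T (insert i A) (insert i B) i - T A (insert i B) i)"
    by (subst (2) sum.swap, subst sum.swap, rule refl)
  also have "\<dots> \<le> (\<Sum>S\<in>Pow I. \<Sum>B\<in>Pow (I - S). 2 ^ card S * R)"
  proof (intro sum_mono)
    fix S B assume S: "S \<in> Pow I" and B: "B \<in> Pow (I - S)"
    have "(\<Sum>i\<in>S. \<Sum>A\<in>Pow (S - {i}). T (insert i A) (insert i B) i - T A (insert i B) i) =
       (\<Sum>i\<in>S. \<Sum>A\<in>Pow (S - {i}). (\<Sum>x\<in>N. K1 (insert i A) x * g1 (insert i B) i x) - (\<Sum>x\<in>N. K1 A x * g1 (insert i B) i x))"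
      by (intro sum.cong refl arg_cong2[where f = "(-)"] T1) (use S B in auto)
    also have "\<dots> \<le> 2 ^ card S * (ln (card N) / l + l * card S / 2)"
    proof (rule sum_influences_le)
      show "finite S"
        using I S finite_subset by auto
      fix A assume "A \<subseteq> S"
      hence A: "A \<subseteq> I"
        using S by auto
      show "K1 A x \<ge> 0" for x
        by (rule K1(1)[OF A])
      show "(\<Sum>x\<in>N. K1 A x) = 1"
        by (rule K1(2)[OF A])
    qed (use N l g in auto)
    also have "\<dots> \<le> 2 ^ card S * R"
      using S by (intro mult_left_mono le_R) auto
    finally show "(\<Sum>i\<in>S. \<Sum>A\<in>Pow (S - {i}). T (insert i A) (insert i B) i - T A (insert i B) i) \<le> 2 ^ card S * R" .
  qed
  also have "\<dots> = (\<Sum>S\<in>Pow I. 2 ^ card I * R)"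
    by (intro sum.cong refl) (use I two in \<open>simp add: card_Pow mult_ac flip: mult.assoc\<close>)
  finally have D1: "D1 \<le> 4 ^ card I * R"
    using I by (simp add: card_Pow flip: mult.assoc power_mult_distrib)
  have "(\<Sum>S\<in>Pow I. \<Sum>i\<in>I - S. \<Sum>A\<in>Pow S. \<Sum>B\<in>Pow (I - S - {i}). \<delta>) \<le>
     (\<Sum>S\<in>Pow I. \<Sum>i\<in>I - S. \<Sum>A\<in>Pow S. \<Sum>B\<in>Pow (I - S - {i}).
        (T (insert i A) (insert i B) i - T A (insert i B) i) + (T A (insert i B) i - T A B i))"
  proof (intro sum_mono)
    fix S i A B
    assume "S \<in> Pow I" "i \<in> I - S" "A \<in> Pow S" "B \<in> Pow (I - S - {i})"
    hence "\<delta> \<le> T (insert i A) (insert i B) i - T A B i"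
      by (intro gap) auto
    thus "\<delta> \<le> (T (insert i A) (insert i B) i - T A (insert i B) i) + (T A (insert i B) i - T A B i)"
      by simp
  qed
  also have "\<dots> = D1 + D2"
    by (simp only: D1_def D2_def sum.distrib)
  also have "\<dots> \<le> 2 * 4 ^ card I * R"
    using D1 D2 by simp
  finally have main: "(\<Sum>S\<in>Pow I. \<Sum>i\<in>I - S. \<Sum>A\<in>Pow S. \<Sum>B\<in>Pow (I - S - {i}). \<delta>) \<le> 2 * 4 ^ card I * R" .
  \<comment> \<open>Counting the tuples: since \<open>B\<close> avoids \<open>i\<close>, half of the
    subsets of \<open>I - S\<close> remain, and \<open>I - S\<close> has on average half of the
    items. The resulting factor 4 and the two increments give the 8.\<close>
  have "2 * (\<Sum>S\<in>Pow I. \<Sum>i\<in>I - S. \<Sum>A\<in>Pow S. \<Sum>B\<in>Pow (I - S - {i}). \<delta>) =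
      (\<Sum>S\<in>Pow I. \<Sum>i\<in>I - S. 2 * (\<Sum>A\<in>Pow S. \<Sum>B\<in>Pow (I - S - {i}). \<delta>))"
    by (simp only: sum_distrib_left)
  also have "\<dots> = (\<Sum>S\<in>Pow I. \<Sum>i\<in>I - S. 2 ^ card I * \<delta>)"
  proof (intro sum.cong refl)
    fix S i assume S: "S \<in> Pow I" and i: "i \<in> I - S"
    have "card (I - S) = Suc (card (I - S - {i}))"
      using I i by (intro card.remove) auto
    thus "2 * (\<Sum>A\<in>Pow S. \<Sum>B\<in>Pow (I - S - {i}). \<delta>) = 2 ^ card I * \<delta>"
      using two[of S] I S by (simp add: card_Pow finite_subset mult_ac)
  qed
  finally have "4 * (\<Sum>S\<in>Pow I. \<Sum>i\<in>I - S. \<Sum>A\<in>Pow S. \<Sum>B\<in>Pow (I - S - {i}). \<delta>) =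
      2 * (\<Sum>S\<in>Pow I. \<Sum>i\<in>I - S. 2 ^ card I * \<delta>)"
    by linarith
  also have "\<dots> = 2 ^ card I * \<delta> * (2 * (\<Sum>S\<in>Pow I. real (card (I - S))))"
    by (simp add: sum_distrib_left mult_ac)
  also have "\<dots> = 4 ^ card I * (\<delta> * card I)"
    unfolding sum_card_Diff_Pow[OF I] by (simp add: mult_ac flip: power_mult_distrib)
  finally have "4 ^ card I * (\<delta> * card I) \<le> 4 ^ card I * (8 * R)"
    using main by linarith
  thus ?thesis
    unfolding R_def by simp
qed


section \<open>Hard graphs and their streams\<close>

text \<open>Item \<open>j\<close> owns the block of vertices from \<open>4 * j\<close> to
  \<open>4 * j + 3\<close>, so division by 4 recovers the item from any vertex. The index
  \<open>k\<close> names both the leaf and the player who draws it.\<close>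

definition item_edge :: "nat \<Rightarrow> nat \<Rightarrow> nat set" where
  "item_edge k j = {4 * j, 4 * j + k}"

definition item_graph :: "(nat \<times> nat) set \<Rightarrow> nat set set" where
  "item_graph P = (\<lambda>(k, j). item_edge k j) ` P"

text \<open>Any order would do, as long as it is determined by \<open>A\<close> alone; sorting fixes
  one.\<close>

definition item_stream :: "nat \<Rightarrow> nat set \<Rightarrow> nat set list" where
  "item_stream k A = map (item_edge k) (sorted_list_of_set A)"

lemma div_4_eq_if_mem_item_edge:
  assumes "v \<in> item_edge k j" "k \<in> {1..3}"
  shows "v div 4 = j"
  using assms by (auto simp: item_edge_def)

lemma item_edge_eq_iff:
  assumes "k \<in> {1..3}" "k' \<in> {1..3}"
  shows "item_edge k j = item_edge k' j' \<longleftrightarrow> k = k' \<and> j = j'"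
proof
  assume eq: "item_edge k j = item_edge k' j'"
  have "4 * j \<in> item_edge k' j'"
    using eq by (auto simp: item_edge_def)
  hence "j = j'"
    using div_4_eq_if_mem_item_edge[OF _ assms(2)] by fastforce
  thus "k = k' \<and> j = j'"
    using eq assms by (auto simp: item_edge_def doubleton_eq_iff)
qed auto

lemma simple_graph_item_graph:
  assumes "P \<subseteq> {1..3} \<times> {..<m}" "4 * m \<le> n"
  shows "simple_graph {..<n} (item_graph P)"
proof -
  have "item_edge k j \<subseteq> {..<n} \<and> card (item_edge k j) = 2" if "(k, j) \<in> P" for k j
    using assms that by (fastforce simp: item_edge_def card_2_iff)
  thus ?thesis
    by (auto simp: simple_graph_def item_graph_def)
qed

text \<open>Edges of different items share no vertex, and injectivity of \<open>snd\<close> leaves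
  at most one edge per item.\<close>

lemma vertex_degree_item_graph_le_1:
  assumes "P \<subseteq> {1..3} \<times> UNIV" "inj_on snd P"
  shows "vertex_degree (item_graph P) v \<le> 1"
proof -
  have "e = f" if ef: "e \<in> item_graph P" "f \<in> item_graph P" "v \<in> e" "v \<in> f" for e f
  proof -
    obtain x y where xy: "x \<in> P" "y \<in> P" "e = item_edge (fst x) (snd x)" "f = item_edge (fst y) (snd y)"
      using ef by (auto simp: item_graph_def)
    moreover have "fst x \<in> {1..3}" "fst y \<in> {1..3}"
      using xy(1,2) assms(1) by auto
    ultimately have "snd x = snd y"
      using ef div_4_eq_if_mem_item_edge by metis
    thus "e = f"
      using xy assms(2) by (auto dest: inj_onD)
  qed
  hence "card {e \<in> item_graph P. v \<in> e} \<le> Suc 0" if "finite {e \<in> item_graph P. v \<in> e}"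
    unfolding card_le_Suc0_iff_eq[OF that] by blast
  thus ?thesis
    unfolding vertex_degree_def by (cases "finite {e \<in> item_graph P. v \<in> e}") auto
qed

lemma vertex_degree_item_graph_ge_3:
  assumes "{1..3} \<times> {i} \<subseteq> P" "finite P"
  shows "vertex_degree (item_graph P) (4 * i) \<ge> 3"
proof -
  have "3 = card ((\<lambda>k. item_edge k i) ` {1..3})"
    by (subst card_image) (auto simp: inj_on_def item_edge_eq_iff)
  also have "\<dots> \<le> vertex_degree (item_graph P) (4 * i)"
    unfolding vertex_degree_def
    by (rule card_mono) (use assms in \<open>auto simp: item_graph_def item_edge_def\<close>)
  finally show ?thesis .
qed

text \<open>Different players draw different leaves, so no edge repeats even when \<open>A\<close>
  and \<open>B\<close> share items.\<close>

lemma item_stream_in_permutations: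
  assumes "finite A" "finite B"
  shows "item_stream 1 A @ item_stream 2 B \<in> permutations_of_set (item_graph ({1} \<times> A \<union> {2} \<times> B))"
    and "item_stream 1 A @ item_stream 2 B @ [item_edge 3 i] \<in>
      permutations_of_set (item_graph ({1} \<times> A \<union> {2} \<times> B \<union> {3} \<times> {i}))"
  using assms
  by (auto simp: permutations_of_set_def item_stream_def item_graph_def distinct_map
      inj_on_def item_edge_eq_iff)

text \<open>As \<open>(1 - \<epsilon>D) * 2\<close> exceeds 1, the ccdh vanishes there and the upper
  bound is 0, whatever \<open>\<epsilon>R\<close> is.\<close>

lemma not_positive_if_degree_le_1:
  assumes "bicriteria_approx \<epsilon>D \<epsilon>R (ccdh V E) C'" "\<epsilon>D < 1/2" "\<And>v. vertex_degree E v \<le> 1"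
  shows "C' 2 \<le> 0"
proof -
  have "{v \<in> V. real (vertex_degree E v) \<ge> (1 - \<epsilon>D) * real 2} = {}"
    using assms(2) assms(3) by (force simp: not_le intro: le_less_trans[of _ 1])
  thus ?thesis
    using assms(1) unfolding bicriteria_approx_def ccdh_def by (metis card.empty mult_zero_right of_nat_0)
qed

text \<open>As \<open>(1 + \<epsilon>D) * 2\<close> is below 3, the ccdh is positive there, and
  \<open>\<epsilon>R < 1\<close> keeps the lower bound positive.\<close>

lemma positive_if_degree_ge_3:
  assumes "bicriteria_approx \<epsilon>D \<epsilon>R (ccdh V E) C'" "\<epsilon>D < 1/2" "\<epsilon>R < 1"
    and "finite V" "v \<in> V" "vertex_degree E v \<ge> 3"
  shows "C' 2 > 0"
proof -
  have "v \<in> {v \<in> V. real (vertex_degree E v) \<ge> (1 + \<epsilon>D) * real 2}"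
    using assms(2,5,6) by (auto simp: algebra_simps)
  hence "ccdh V E ((1 + \<epsilon>D) * real 2) > 0"
    unfolding ccdh_def using assms(4) by (auto simp: card_gt_0_iff)
  hence "0 < (1 - \<epsilon>R) * real (ccdh V E ((1 + \<epsilon>D) * real 2))"
    using assms(3) by simp
  also have "\<dots> \<le> C' 2"
    using assms(1) unfolding bicriteria_approx_def by (metis of_nat_numeral)
  finally show ?thesis .
qed

section \<open>Cutting a run at a memory state\<close>

text \<open>Generalises \<open>memory_after\<close> to an arbitrary initial distribution, so that a
  run can resume from a single handed-over state.\<close>

definition continue_from :: "'v streaming_algorithm \<Rightarrow> bool list pmf \<Rightarrow> 'v set list \<Rightarrow> bool list pmf" where
  "continue_from A = foldl (\<lambda>M e. bind_pmf M (\<lambda>x. update A x e))"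

lemma continue_from_bind:
  "continue_from A M es = bind_pmf M (\<lambda>x. continue_from A (return_pmf x) es)"
proof (induction es rule: rev_induct)
  case (snoc e es)
  thus ?case
    by (simp add: continue_from_def bind_assoc_pmf)
qed (simp add: continue_from_def bind_return_pmf')

lemma memory_after_append:
  "memory_after A (xs @ ys) = bind_pmf (memory_after A xs) (\<lambda>x. continue_from A (return_pmf x) ys)"
  by (subst continue_from_bind[symmetric]) (simp add: memory_after_def continue_from_def)

lemma prob_bind_pmf:
  "measure_pmf.prob (bind_pmf M f) X = (\<integral>x. measure_pmf.prob (f x) X \<partial>measure_pmf M)"
  unfolding measure_pmf_bind
  by (subst measure_pmf.measure_bind[where N = "count_space UNIV"]) (auto simp: measure_subprob)

text \<open>The Markov property: \<open>xs\<close> influences the output only through the state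
  reached, which thus acts as a one-way message.\<close>

lemma prob_output_append:
  assumes "finite N" "set_pmf (memory_after A xs) \<subseteq> N"
  shows "measure_pmf.prob (output_dist A (xs @ ys)) X =
    (\<Sum>x\<in>N. pmf (memory_after A xs) x *
       measure_pmf.prob (bind_pmf (continue_from A (return_pmf x) ys) (result A)) X)"
  unfolding output_dist_def memory_after_append bind_assoc_pmf
  by (subst prob_bind_pmf, subst integral_measure_pmf[OF assms(1)]) (use assms(2) in auto)

lemma card_lists_bool_le:
  "finite {x :: bool list. length x \<le> s}" "card {x :: bool list. length x \<le> s} \<le> 2 ^ (s + 1)"
proof -
  have eq: "{x :: bool list. length x \<le> s} = {x. set x \<subseteq> UNIV \<and> length x \<le> s}"
    by simp
  show "finite {x :: bool list. length x \<le> s}"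
    unfolding eq by (rule finite_lists_length_le) simp
  have "card {x :: bool list. length x \<le> s} = (\<Sum>i\<le>s. 2 ^ i)"
    unfolding eq by (subst card_lists_length_le) simp_all
  also have "\<dots> \<le> 2 ^ (s + 1)"
    by (induction s) auto
  finally show "card {x :: bool list. length x \<le> s} \<le> 2 ^ (s + 1)" .
qed

section \<open>From communication to space\<close>

lemma space_lower_bound:
  fixes A :: "nat streaming_algorithm"
  assumes A: "computes_ccdh_approx A {..<n} {E. simple_graph {..<n} E} \<epsilon>D \<epsilon>R p"
    and space: "uses_space_at_most A {E. simple_graph {..<n} E} s"
    and "\<epsilon>D < 1/2" "\<epsilon>R < 1" "4 * m \<le> n" "p > 1/2"
  shows "(2 * p - 1)\<^sup>2 * m \<le> 128 * (real s + 1)"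
proof -
  define \<delta> where "\<delta> = 2 * p - 1"
  \<comment> \<open>With this \<open>l\<close> the term \<open>8 * (l * m / 2)\<close> is half of
    \<open>\<delta> * m\<close> and can be absorbed on the left.\<close>
  define l where "l = \<delta> / 8"
  have \<delta>: "\<delta> > 0" and l: "l > 0"
    using assms by (auto simp: \<delta>_def l_def)
  define N where "N = {x :: bool list. length x \<le> s}"
  have N: "finite N" "N \<noteq> {}"
    using card_lists_bool_le[of s] by (auto simp: N_def intro: exI[of _ "[]"])
  define query where "query i = [item_edge 3 i]" for i
  define Pos where "Pos = {C' :: nat \<Rightarrow> real. C' 2 > 0}"
  define accept where
    "accept x es = measure_pmf.prob (bind_pmf (continue_from A (return_pmf x) es) (result A)) Pos" for x es
  define T where "T X Y i = measure_pmf.prob (output_dist A (item_stream 1 X @ item_stream 2 Y @ query i)) Pos" for X Y i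
  \<comment> \<open>The stream without the query edge is itself a complete stream of a simple graph,
    so the space bound applies to its final state. An empty \<open>Y\<close> yields the first
    player's state.\<close>
  have memory: "set_pmf (memory_after A (item_stream 1 X @ item_stream 2 Y)) \<subseteq> N"
    if "X \<subseteq> {..<m}" "Y \<subseteq> {..<m}" for X Y
  proof -
    have fin: "finite X" "finite Y"
      using that finite_subset by blast+
    have "simple_graph {..<n} (item_graph ({1} \<times> X \<union> {2} \<times> Y))"
      using that assms by (intro simple_graph_item_graph[of _ m]) auto
    hence "length x \<le> s" if "x \<in> set_pmf (memory_after A (item_stream 1 X @ item_stream 2 Y))" for x
      using space item_stream_in_permutations(1)[OF fin] that
      unfolding uses_space_at_most_def by (metis mem_Collect_eq order_refl take_all_iff)
    thus ?thesis
      by (auto simp: N_def)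
  qed
  have memory1: "set_pmf (memory_after A (item_stream 1 X)) \<subseteq> N" if "X \<subseteq> {..<m}" for X
    using memory[OF that, of "{}"] by (simp add: item_stream_def)
  have correct: "measure_pmf.prob (output_dist A (item_stream 1 X @ item_stream 2 Y @ query i))
      {C'. bicriteria_approx \<epsilon>D \<epsilon>R (ccdh {..<n} (item_graph ({1} \<times> X \<union> {2} \<times> Y \<union> {3} \<times> {i}))) C'} \<ge> p"
    if "X \<subseteq> {..<m}" "Y \<subseteq> {..<m}" "i \<in> {..<m}" for X Y i
  proof -
    have fin: "finite X" "finite Y"
      using that finite_subset by blast+
    have "simple_graph {..<n} (item_graph ({1} \<times> X \<union> {2} \<times> Y \<union> {3} \<times> {i}))"
      using that assms by (intro simple_graph_item_graph[of _ m]) auto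
    thus ?thesis
      using A item_stream_in_permutations(2)[OF fin, of i]
      unfolding computes_ccdh_approx_def query_def by blast
  qed
  have "\<delta> * card {..<m} \<le> 8 * (ln (card N) / l + l * card {..<m} / 2)"
  proof (rule three_party_bound[where T = T
        and ?K1.0 = "\<lambda>X. pmf (memory_after A (item_stream 1 X))"
        and ?K2.0 = "\<lambda>X Y. pmf (memory_after A (item_stream 1 X @ item_stream 2 Y))"
        and ?g1.0 = "\<lambda>Y i x. accept x (item_stream 2 Y @ query i)"
        and ?g2.0 = "\<lambda>i x. accept x (query i)"])
    fix X :: "nat set" assume X: "X \<subseteq> {..<m}"
    show "(\<Sum>x\<in>N. pmf (memory_after A (item_stream 1 X)) x) = 1"
      using memory1[OF X] N by (intro sum_pmf_eq_1)
    fix Y i assume Y: "Y \<subseteq> {..<m}"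
    show "(\<Sum>x\<in>N. pmf (memory_after A (item_stream 1 X @ item_stream 2 Y)) x) = 1"
      using memory[OF X Y] N by (intro sum_pmf_eq_1)
    assume i: "i \<in> {..<m}"
    show "T X Y i = (\<Sum>x\<in>N. pmf (memory_after A (item_stream 1 X)) x * accept x (item_stream 2 Y @ query i))"
      unfolding T_def accept_def by (rule prob_output_append[OF N(1) memory1[OF X]])
    show "T X Y i = (\<Sum>x\<in>N. pmf (memory_after A (item_stream 1 X @ item_stream 2 Y)) x * accept x (query i))"
      unfolding T_def accept_def append_assoc[symmetric]
      by (rule prob_output_append[OF N(1) memory[OF X Y]])
    assume XY: "X \<inter> Y = {}" "i \<notin> X \<union> Y"
    let ?E = "item_graph ({1} \<times> X \<union> {2} \<times> Y \<union> {3} \<times> {i})"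
    let ?E' = "item_graph ({1} \<times> insert i X \<union> {2} \<times> insert i Y \<union> {3} \<times> {i})"
    have deg: "vertex_degree ?E v \<le> 1" for v
      using XY by (intro vertex_degree_item_graph_le_1) (auto simp: inj_on_def)
    have "p \<le> measure_pmf.prob (output_dist A (item_stream 1 X @ item_stream 2 Y @ query i))
        {C'. bicriteria_approx \<epsilon>D \<epsilon>R (ccdh {..<n} ?E) C'}"
      by (rule correct[OF X Y i])
    also have "\<dots> \<le> measure_pmf.prob (output_dist A (item_stream 1 X @ item_stream 2 Y @ query i)) (- Pos)"
      by (intro measure_pmf.finite_measure_mono)
        (use not_positive_if_degree_le_1[OF _ assms(3) deg] in \<open>force simp: Pos_def\<close>)+
    \<comment> \<open>Rejection has probability at least \<open>p\<close> here, while below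
      acceptance does; the gap is \<open>p - (1 - p)\<close>, which is \<delta>.\<close>
    also have "\<dots> = 1 - T X Y i"
      unfolding T_def using measure_pmf.prob_compl[of Pos] by (simp add: Compl_eq_Diff_UNIV)
    finally have low: "T X Y i \<le> 1 - p"
      by simp
    have fin: "finite X" "finite Y"
      using X Y finite_subset by blast+
    have deg': "vertex_degree ?E' (4 * i) \<ge> 3"
    proof (rule vertex_degree_item_graph_ge_3)
      have "{1..3} = {1, 2, 3 :: nat}"
        by auto
      thus "{1..3 :: nat} \<times> {i} \<subseteq> {1} \<times> insert i X \<union> {2} \<times> insert i Y \<union> {3} \<times> {i}"
        by auto
    qed (use fin in auto)
    have "4 * i \<in> {..<n}"
      using i assms by auto
    note pos = positive_if_degree_ge_3[OF _ assms(3,4) finite_lessThan this deg']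
    have "p \<le> measure_pmf.prob (output_dist A (item_stream 1 (insert i X) @ item_stream 2 (insert i Y) @ query i))
        {C'. bicriteria_approx \<epsilon>D \<epsilon>R (ccdh {..<n} ?E') C'}"
      using X Y i by (intro correct) auto
    also have "\<dots> \<le> T (insert i X) (insert i Y) i"
      unfolding T_def by (intro measure_pmf.finite_measure_mono) (use pos in \<open>auto simp: Pos_def\<close>)
    finally show "\<delta> \<le> T (insert i X) (insert i Y) i - T X Y i"
      using low by (simp add: \<delta>_def)
  qed (use N l in \<open>auto simp: accept_def\<close>)
  also have "ln (card N) \<le> real s + 1"
  proof -
    have "real (card N) \<le> 2 ^ (s + 1)"
      using card_lists_bool_le(2)[of s] unfolding N_def
      by (metis of_nat_le_iff of_nat_numeral of_nat_power)
    hence "ln (card N) \<le> ln (2 ^ (s + 1))"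
      using N by (subst ln_le_cancel_iff) (auto simp: card_gt_0_iff)
    also have "\<dots> = (real s + 1) * ln 2"
      by (subst ln_realpow) auto
    also have "\<dots> \<le> real s + 1"
      using ln_2_less_1 by (intro mult_left_le) auto
    finally show ?thesis .
  qed
  finally have "\<delta> * m \<le> 8 * ((real s + 1) / l + l * m / 2)"
    using l by (simp add: divide_right_mono)
  hence "\<delta> * m / 2 \<le> (64 * (real s + 1)) / \<delta>"
    by (simp add: l_def add_divide_distrib)
  hence "\<delta> * m / 2 * \<delta> \<le> 64 * (real s + 1)"
    using \<delta> by (simp only: pos_le_divide_eq)
  thus ?thesis
    unfolding \<delta>_def[symmetric] by (simp add: power2_eq_square mult_ac)
qed

theorem theorem6p3:
  "\<exists>\<G> :: nat \<Rightarrow> nat set set set.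
     (\<forall>n. \<G> n \<noteq> {} \<and> (\<forall>E\<in>\<G> n. simple_graph {..<n} E)) \<and>
     (\<forall>p::real. p > 1/2 \<longrightarrow>
       (\<exists>c::real. c > 0 \<and>
         (\<forall>\<^sub>F n in sequentially.
            \<forall>(\<epsilon>D::real) (\<epsilon>R::real) (A :: nat streaming_algorithm) (s::nat).
              0 \<le> \<epsilon>D \<longrightarrow> \<epsilon>D < 1/2 \<longrightarrow> 0 \<le> \<epsilon>R \<longrightarrow> \<epsilon>R < 1 \<longrightarrow>
              computes_ccdh_approx A {..<n} (\<G> n) \<epsilon>D \<epsilon>R p \<longrightarrow>
              uses_space_at_most A (\<G> n) s \<longrightarrow>
              real s \<ge> c * real n)))"
\<comment> \<open>The class of all simple graphs on \<open>n\<close> vertices contains the hard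
  instances.\<close>
proof (intro exI[of _ "\<lambda>n. {E. simple_graph {..<n} E}"] conjI allI impI)
  fix n :: nat
  show "{E. simple_graph {..<n} E} \<noteq> {}"
    by (auto simp: simple_graph_def)
  show "\<forall>E\<in>{E. simple_graph {..<n} E}. simple_graph {..<n} E"
    by simp
next
  fix p :: real assume p: "p > 1/2"
  define q where "q = (2 * p - 1)\<^sup>2"
  have q: "q > 0"
    using p by (simp add: q_def)
  \<comment> \<open>Rounding in \<open>n div 4\<close> and the \<open>+ 1\<close> in the space bound
    give \<open>q * n \<le> 512 * s + 512 + 4 * q\<close>. For such \<open>n\<close> the last two
    terms are at most half of \<open>q * n\<close>, whence the constant
    \<open>q / 1024\<close>.\<close>
  have "\<forall>\<^sub>F n in sequentially. real n \<ge> 8 + 1024 / q"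
    using filterlim_real_sequentially unfolding filterlim_at_top by blast
  hence "\<forall>\<^sub>F n in sequentially. \<forall>\<epsilon>D \<epsilon>R (A :: nat streaming_algorithm) s.
      0 \<le> \<epsilon>D \<longrightarrow> \<epsilon>D < 1/2 \<longrightarrow> 0 \<le> \<epsilon>R \<longrightarrow> \<epsilon>R < 1 \<longrightarrow>
      computes_ccdh_approx A {..<n} {E. simple_graph {..<n} E} \<epsilon>D \<epsilon>R p \<longrightarrow>
      uses_space_at_most A {E. simple_graph {..<n} E} s \<longrightarrow> real s \<ge> q / 1024 * real n"
  proof (eventually_elim, safe)
    fix n s and \<epsilon>D \<epsilon>R :: real and A :: "nat streaming_algorithm"
    assume n: "real n \<ge> 8 + 1024 / q" and "\<epsilon>D < 1/2" "\<epsilon>R < 1"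
      "computes_ccdh_approx A {..<n} {E. simple_graph {..<n} E} \<epsilon>D \<epsilon>R p"
      "uses_space_at_most A {E. simple_graph {..<n} E} s"
    hence bound: "q * real (n div 4) \<le> 128 * (real s + 1)"
      unfolding q_def using p by (intro space_lower_bound[where \<epsilon>D = \<epsilon>D and \<epsilon>R = \<epsilon>R]) auto
    have "real n \<le> 4 * real (n div 4) + 4"
      by linarith
    hence "q * real n \<le> q * (4 * real (n div 4) + 4)"
      using q by (intro mult_left_mono) auto
    moreover have "q * (8 + 1024 / q) \<le> q * real n"
      using q n by (intro mult_left_mono) auto
    hence "8 * q + 1024 \<le> q * real n"
      using q by (simp add: distrib_left)
    ultimately show "real s \<ge> q / 1024 * real n"
      using bound by (simp add: algebra_simps)
  qed
  thus "\<exists>c>0. \<forall>\<^sub>F n in sequentially. \<forall>\<epsilon>D \<epsilon>R (A :: nat streaming_algorithm) s.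
      0 \<le> \<epsilon>D \<longrightarrow> \<epsilon>D < 1/2 \<longrightarrow> 0 \<le> \<epsilon>R \<longrightarrow> \<epsilon>R < 1 \<longrightarrow>
      computes_ccdh_approx A {..<n} {E. simple_graph {..<n} E} \<epsilon>D \<epsilon>R p \<longrightarrow>
      uses_space_at_most A {E. simple_graph {..<n} E} s \<longrightarrow> c * real n \<le> real s"
    using q by (intro exI[of _ "q / 1024"]) auto
qed

end
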